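(* Let $n\ge7$. If $n\equiv0$ or $2\pmod3$, there is a collection of $\frac13\binom{n-5}{2}$ rowmotion orbits on $\mathcal{IC}([2]\times[n])$, each of size $n+5$, that together include all ICS of the form $[x-1,y,n-x-y+1:\varnothing]$ with $x,y\ge4$ (and $x+y\le n+1$). If $n\equiv1\pmod3$, there is a collection consisting of one orbit of size $\frac{n+5}{3}$ and $\frac{(n-4)(n-7)}{6}$ orbits of size $n+5$ that together include all such ICS.
   Context: $[2]\times[n]=\{(i,j): i\in\{1,2\},1\le j\le n\}$ with the componentwise order. An interval-closed set (ICS) is a subset $I$ with $x,y\in I$, $x\le z\le y\Rightarrow z\in I$. The toggle $t_x$ sends $I$ to $I\triangle\{x\}$ if this is an ICS, and to $I$ otherwise; rowmotion is $\mathrm{Row}=t_{x_1}\circ\cdots\circ t_{x_N}$ for any linear extension $x_1,\dots,x_N$ (toggles applied top to bottom). For nonnegative $b+i+a=n$, $[b,i,a:\varnothing]$ denotes $\{(1,j): b<j\le b+i\}$. *)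

theory Defs
  imports
    Complex_Main
    "HOL-Library.Product_Order"
    "HOL-Combinatorics.Orbits"
begin

(* Product_Order supplies the componentwise order on nat * nat. *)

definition two_by :: "nat \<Rightarrow> (nat \<times> nat) set" where
  "two_by n = {1, 2} \<times> {1..n}"

definition ICS :: "'a::order set \<Rightarrow> 'a set set" where
  "ICS P = {I. I \<subseteq> P \<and> (\<forall>x\<in>I. \<forall>y\<in>I. \<forall>z\<in>P. x \<le> z \<and> z \<le> y \<longrightarrow> z \<in> I)}"

definition toggle :: "'a::order set \<Rightarrow> 'a \<Rightarrow> 'a set \<Rightarrow> 'a set" where
  "toggle P x I = (if sym_diff I {x} \<in> ICS P then sym_diff I {x} else I)"

definition linear_extension :: "'a::order set \<Rightarrow> 'a list \<Rightarrow> bool" where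
  "linear_extension P xs \<longleftrightarrow> distinct xs \<and> set xs = P \<and>
     (\<forall>i<length xs. \<forall>j<length xs. xs ! i \<le> xs ! j \<longrightarrow> i \<le> j)"

(* For xs = [x1, ..., xN] this is toggle P x1 o ... o toggle P xN, so the last (top)
   element of the linear extension is toggled first. *)
definition rowmotion :: "'a::order set \<Rightarrow> 'a list \<Rightarrow> 'a set \<Rightarrow> 'a set" where
  "rowmotion P xs = foldr (toggle P) xs"

(* The library's orbit consists of the iterates with positive exponent. Each toggle is an
   involution of ICS P, so for finite P and I in ICS P this is the full orbit of I,
   including I itself. *)
definition rowmotion_orbits :: "'a::order set \<Rightarrow> 'a list \<Rightarrow> 'a set set set" where
  "rowmotion_orbits P xs = orbit (rowmotion P xs) ` ICS P"

(* [b, i, a : {}] as a subset of two_by (b + i + a). The number a of unused cells on the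
   right only records n = b + i + a and does not affect the underlying set. *)
definition block :: "nat \<Rightarrow> nat \<Rightarrow> nat \<Rightarrow> (nat \<times> nat) set" where
  "block b i a = {(1, j) | j. b < j \<and> j \<le> b + i}"

end

(* Let x, y, z >= 4 with x + y + z = n + 5. Starting from the segment {x, ..., x+y-1} of the lower
   row, rowmotion first creates the segment {1, ..., x} in the upper row and then shifts both segments
   to the right; when the lower one hits the end of its row, three more steps turn the
   configuration into the segment {z, ..., z+x-1} of the lower row. So z steps rotate (x, y, z) to
   (z, x, y), and the upper row is nonempty in between. Hence the orbit closes up after n + 5 steps
   and meets the lower-row segments exactly in the rotations of (x, y, z); it is shorter only when
   x = y = z. The number of triples is (n - 5) choose 2. *)

theory Submission
  imports Defs
begin

section \<open>Toggles and rowmotion on a general poset\<close>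

lemma toggle_in_ICS: "I \<in> ICS P \<Longrightarrow> toggle P x I \<in> ICS P"
  by (simp add: toggle_def)

lemma rowmotion_in_ICS: "I \<in> ICS P \<Longrightarrow> rowmotion P xs I \<in> ICS P"
  unfolding rowmotion_def by (induction xs) (auto intro: toggle_in_ICS)

text \<open>Since \<open>M\<close> is convex, any violation after the insertion has \<open>x\<close>
  as an endpoint; so only the open intervals between \<open>x\<close> and members of
  \<open>M\<close> have to be filled.\<close>

lemma ICS_insert_iff:
  assumes "M \<in> ICS P" "x \<in> P" "x \<notin> M"
  shows "insert x M \<in> ICS P \<longleftrightarrow>
    (\<forall>a\<in>M. a < x \<longrightarrow> {a<..<x} \<inter> P \<subseteq> M) \<and> (\<forall>b\<in>M. x < b \<longrightarrow> {x<..<b} \<inter> P \<subseteq> M)"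
    (is "?L \<longleftrightarrow> ?R")
proof
  assume ?L
  then show ?R
    unfolding ICS_def by (auto simp: less_le_not_le) (metis less_le_not_le)+
next
  assume R: ?R
  have conv: "z \<in> M" if "u \<in> M" "v \<in> M" "z \<in> P" "u \<le> z" "z \<le> v" for u v z
    using assms that unfolding ICS_def by blast
  have "z \<in> insert x M" if uvz: "u \<in> insert x M" "v \<in> insert x M" "z \<in> P" "u \<le> z" "z \<le> v" for u v z
  proof (rule ccontr)
    assume z: "z \<notin> insert x M"
    then have "u < z" "z < v" using that by (auto simp: order.strict_iff_order)
    moreover have "u \<notin> M \<or> v \<notin> M" using conv that z by blast
    ultimately consider "u = x" "v \<in> M" | "u \<in> M" "v = x"
      using uvz order.strict_trans[of x z x] by auto
    then show False
    proof cases
      case 1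
      then have "{x<..<v} \<inter> P \<subseteq> M" using R \<open>u < z\<close> \<open>z < v\<close> by fastforce
      then show False using 1 \<open>u < z\<close> \<open>z < v\<close> \<open>z \<in> P\<close> z by auto
    next
      case 2
      then have "{u<..<x} \<inter> P \<subseteq> M" using R \<open>u < z\<close> \<open>z < v\<close> by fastforce
      then show False using 2 \<open>u < z\<close> \<open>z < v\<close> \<open>z \<in> P\<close> z by auto
    qed
  qed
  then show ?L using assms unfolding ICS_def by blast
qed

text \<open>The only possible new gap is \<open>x\<close> itself, strictly between two remaining
  members.\<close>

lemma ICS_remove_iff:
  assumes "M \<in> ICS P" "x \<in> M"
  shows "M - {x} \<in> ICS P \<longleftrightarrow> \<not> ((\<exists>a\<in>M. a < x) \<and> (\<exists>b\<in>M. x < b))"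
proof
  assume L: "M - {x} \<in> ICS P"
  show "\<not> ((\<exists>a\<in>M. a < x) \<and> (\<exists>b\<in>M. x < b))"
  proof
    assume "(\<exists>a\<in>M. a < x) \<and> (\<exists>b\<in>M. x < b)"
    then obtain a b where "a \<in> M - {x}" "b \<in> M - {x}" "a \<le> x" "x \<le> b"
      by (auto simp: order.strict_iff_order)
    moreover have "x \<in> P" using assms by (auto simp: ICS_def)
    ultimately have "x \<in> M - {x}" using L unfolding ICS_def by blast
    then show False by simp
  qed
next
  assume R: "\<not> ((\<exists>a\<in>M. a < x) \<and> (\<exists>b\<in>M. x < b))"
  have "z \<in> M - {x}" if "u \<in> M - {x}" "v \<in> M - {x}" "z \<in> P" "u \<le> z" "z \<le> v" for u v z
  proof -
    have "z \<in> M" using assms that unfolding ICS_def by blast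
    moreover have "z \<noteq> x" using R that by (auto simp: order.strict_iff_order)
    ultimately show ?thesis by simp
  qed
  then show "M - {x} \<in> ICS P" using assms unfolding ICS_def by blast
qed

text \<open>In this form the toggle at \<open>x\<close> reads \<open>M\<close> only at elements
  comparable to \<open>x\<close>, which makes the recursion in \<open>rowmotion_eqI\<close>
  possible.\<close>

lemma toggle_mem_iff:
  assumes "M \<in> ICS P" "x \<in> P"
  shows "x \<in> toggle P x M \<longleftrightarrow>
    (if x \<in> M then (\<exists>a\<in>M. a < x) \<and> (\<exists>b\<in>M. x < b)
     else (\<forall>a\<in>M. a < x \<longrightarrow> {a<..<x} \<inter> P \<subseteq> M) \<and> (\<forall>b\<in>M. x < b \<longrightarrow> {x<..<b} \<inter> P \<subseteq> M))"
proof (cases "x \<in> M")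
  case True
  then have "sym_diff M {x} = M - {x}" by auto
  with True show ?thesis using ICS_remove_iff[OF assms(1) True] by (auto simp: toggle_def)
next
  case False
  then have "sym_diff M {x} = insert x M" by auto
  with False show ?thesis using ICS_insert_iff[OF assms False] by (auto simp: toggle_def)
qed

lemma toggle_mem_other: "y \<noteq> x \<Longrightarrow> y \<in> toggle P x M \<longleftrightarrow> y \<in> M"
  by (auto simp: toggle_def)

text \<open>When x is toggled, the elements above it already have their new status and those below it
  still have their old one; incomparable elements do not matter.\<close>

lemma rowmotion_eqI:
  assumes lin: "linear_extension P xs" and I: "I \<in> ICS P" and J: "J \<subseteq> P"
    and eq: "\<And>x. x \<in> P \<Longrightarrow> x \<in> J \<longleftrightarrow>
      (if x \<in> I then (\<exists>a\<in>I. a < x) \<and> (\<exists>b\<in>J. x < b)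
       else (\<forall>a\<in>I. a < x \<longrightarrow> {a<..<x} \<inter> P \<subseteq> I) \<and> (\<forall>b\<in>J. x < b \<longrightarrow> {x<..<b} \<inter> P \<subseteq> J))"
  shows "rowmotion P xs I = J"
proof -
  have P: "set xs = P" and dist: "distinct xs"
    and ord: "\<And>i j. i < length xs \<Longrightarrow> j < length xs \<Longrightarrow> xs ! i \<le> xs ! j \<Longrightarrow> i \<le> j"
    using lin by (auto simp: linear_extension_def)
  have IP: "I \<subseteq> P" using I by (auto simp: ICS_def)
  \<comment> \<open>The suffix \<open>vs\<close> has been toggled already and carries the new set;
    the prefix \<open>us\<close> still carries the old one.\<close>
  have "foldr (toggle P) vs I = I \<inter> set us \<union> J \<inter> set vs" if "xs = us @ vs" for us vs
    using that
  proof (induction vs arbitrary: us)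
    case Nil
    then show ?case using IP P by auto
  next
    case (Cons v vs)
    define M where "M = foldr (toggle P) vs I"
    have M: "M = I \<inter> set (us @ [v]) \<union> J \<inter> set vs"
      using Cons.IH[of "us @ [v]"] Cons.prems by (simp add: M_def)
    have MI: "M \<in> ICS P" using rowmotion_in_ICS[OF I, of vs] by (simp add: M_def rowmotion_def)
    have v: "v \<in> P" "v \<notin> set us" "v \<notin> set vs" "set us \<inter> set vs = {}" using Cons.prems P dist by auto
    have above: "b \<in> set vs" if "b \<in> P" "v < b" for b
    proof (rule ccontr)
      assume "b \<notin> set vs"
      then have "b \<in> set us" using that P Cons.prems by auto
      then obtain i where i: "i < length us" "us ! i = b" by (auto simp: in_set_conv_nth)
      have "length us \<le> i"
        using ord[of "length us" i] i that Cons.prems by (auto simp: nth_append less_imp_le)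
      then show False using i by simp
    qed
    have below: "a \<in> set us" if "a \<in> P" "a < v" for a
    proof (rule ccontr)
      assume "a \<notin> set us"
      then have "a \<in> set vs" using that P Cons.prems by auto
      then obtain i where i: "i < length vs" "vs ! i = a" by (auto simp: in_set_conv_nth)
      have "length us + Suc i \<le> length us"
        using ord[of "length us + Suc i" "length us"] i that Cons.prems by (auto simp: nth_append less_imp_le)
      then show False by simp
    qed
    have MB: "a \<in> M \<longleftrightarrow> a \<in> I" if "a \<in> P" "a < v" for a
      using below[OF that] v by (auto simp: M)
    have MA: "b \<in> M \<longleftrightarrow> b \<in> J" if "b \<in> P" "v < b" for b
      using above[OF that] v that by (auto simp: M)
    have Mv: "v \<in> M \<longleftrightarrow> v \<in> I" using v by (auto simp: M)
    have MP: "M \<subseteq> P" using MI by (auto simp: ICS_def)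
    \<comment> \<open>\<open>M\<close> agrees with \<open>I\<close> below \<open>v\<close> and with
      \<open>J\<close> above it, so each of the four toggle conditions can be moved from
      \<open>M\<close> to \<open>I\<close> or \<open>J\<close>.\<close>
    have e1: "(\<exists>a\<in>M. a < v) \<longleftrightarrow> (\<exists>a\<in>I. a < v)" using MB MP IP by blast
    have e2: "(\<exists>b\<in>M. v < b) \<longleftrightarrow> (\<exists>b\<in>J. v < b)" using MA MP J by blast
    have e3: "(\<forall>a\<in>M. a < v \<longrightarrow> {a<..<v} \<inter> P \<subseteq> M) \<longleftrightarrow> (\<forall>a\<in>I. a < v \<longrightarrow> {a<..<v} \<inter> P \<subseteq> I)"
    proof -
      have "{a<..<v} \<inter> P \<subseteq> M \<longleftrightarrow> {a<..<v} \<inter> P \<subseteq> I" for a using MB by auto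
      then show ?thesis using MB MP IP by blast
    qed
    have e4: "(\<forall>b\<in>M. v < b \<longrightarrow> {v<..<b} \<inter> P \<subseteq> M) \<longleftrightarrow> (\<forall>b\<in>J. v < b \<longrightarrow> {v<..<b} \<inter> P \<subseteq> J)"
    proof -
      have "{v<..<b} \<inter> P \<subseteq> M \<longleftrightarrow> {v<..<b} \<inter> P \<subseteq> J" for b using MA by auto
      then show ?thesis using MA MP J by blast
    qed
    have mem: "v \<in> toggle P v M \<longleftrightarrow> v \<in> J"
      unfolding toggle_mem_iff[OF MI v(1)] eq[OF v(1)] e1 e2 e3 e4 Mv ..
    have "y \<in> toggle P v M \<longleftrightarrow> y \<in> I \<inter> set us \<union> J \<inter> set (v # vs)" for y
    proof (cases "y = v")
      case True
      then show ?thesis using mem v by simp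
    next
      case False
      then show ?thesis by (auto simp: toggle_mem_other M)
    qed
    then have "toggle P v M = I \<inter> set us \<union> J \<inter> set (v # vs)" by blast
    then show ?case by (simp add: M_def)
  qed
  from this[of "[]" xs] show ?thesis using J P by (auto simp: rowmotion_def)
qed

section \<open>Orbits of a periodic point\<close>

lemma orbit_eq_funpow_image:
  assumes "(f ^^ p) s = s" "0 < p"
  shows "orbit f s = (\<lambda>k. (f ^^ k) s) ` {..<p}"
proof -
  have "(f ^^ k) s \<in> (\<lambda>k. (f ^^ k) s) ` {..<p}" for k
    using funpow_mod_eq[of p f s k] assms
    by (metis image_eqI lessThan_iff mod_less_divisor)
  moreover have "(f ^^ k) s \<in> orbit f s" for k
  proof -
    \<comment> \<open>\<open>orbit\<close> uses positive exponents only; adding the period makes the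
      exponent positive even for \<open>k = 0\<close>.\<close>
    have "(f ^^ (k + p)) s = (f ^^ k) s" using assms by (simp add: funpow_add)
    then show ?thesis using assms unfolding orbit_altdef by (metis (mono_tags, lifting) add_gr_0 mem_Collect_eq)
  qed
  ultimately show ?thesis by (auto simp: orbit_altdef)
qed

lemma card_orbit_eq_period:
  assumes p: "(f ^^ p) s = s" "0 < p" and min: "\<And>k. 0 < k \<Longrightarrow> k < p \<Longrightarrow> (f ^^ k) s \<noteq> s"
  shows "card (orbit f s) = p"
proof -
  have ne: "(f ^^ i) s \<noteq> (f ^^ j) s" if "i < j" "j < p" for i j
  proof
    assume "(f ^^ i) s = (f ^^ j) s"
    \<comment> \<open>After \<open>p - j\<close> further steps the right side is back at
      \<open>s\<close>, so the left side returns at a time strictly between 0 and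
      \<open>p\<close>.\<close>
    then have "(f ^^ (p - j + i)) s = (f ^^ (p - j + j)) s" by (simp only: funpow_add comp_apply)
    then show False using min[of "p - j + i"] that p by (simp del: add_diff_assoc2)
  qed
  have "inj_on (\<lambda>k. (f ^^ k) s) {..<p}"
    by (rule inj_onI) (metis lessThan_iff linorder_neqE_nat ne)
  then show ?thesis using orbit_eq_funpow_image[OF p] by (simp add: card_image)
qed

section \<open>Sets made of one interval in each row\<close>

text \<open>Bounds in decreasing order encode an empty row; below this is always written
  \<open>1 0\<close>.\<close>

definition rows :: "nat \<Rightarrow> nat \<Rightarrow> nat \<Rightarrow> nat \<Rightarrow> (nat \<times> nat) set" where
  "rows a b c d = {1} \<times> {a..b} \<union> {2} \<times> {c..d}"

lemma prod_less_iff: "(p :: nat \<times> nat) < q \<longleftrightarrow> fst p \<le> fst q \<and> snd p \<le> snd q \<and> p \<noteq> q"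
  by (auto simp: order.strict_iff_order less_eq_prod_def prod_eq_iff)

lemma bex_rows: "(\<exists>y\<in>rows a b c d. Q y) \<longleftrightarrow>
    (\<exists>i. a \<le> i \<and> i \<le> b \<and> Q (1, i)) \<or> (\<exists>i. c \<le> i \<and> i \<le> d \<and> Q (2, i))"
  by (auto simp: rows_def)

text \<open>Only the first cell of each row has to be tested below a point, and only the last one
  above it; so the existence conditions become linear inequalities.\<close>

lemma rows_below1: "(\<exists>y\<in>rows a b c d. y < (1, j)) \<longleftrightarrow> a \<le> b \<and> a < j"
  unfolding bex_rows prod_less_iff by simp presburger

lemma rows_below2: "(\<exists>y\<in>rows a b c d. y < (2, j)) \<longleftrightarrow> a \<le> b \<and> a \<le> j \<or> c \<le> d \<and> c < j"
  unfolding bex_rows prod_less_iff by simp presburger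

lemma rows_above1: "(\<exists>y\<in>rows a b c d. (1, j) < y) \<longleftrightarrow> a \<le> b \<and> j < b \<or> c \<le> d \<and> j \<le> d"
  unfolding bex_rows prod_less_iff by simp presburger

lemma rows_above2: "(\<exists>y\<in>rows a b c d. (2, j) < y) \<longleftrightarrow> c \<le> d \<and> j < d"
  unfolding bex_rows prod_less_iff by simp presburger

text \<open>Upper cells are never below \<open>(1, j)\<close>, so the condition can fail only by a
  gap after \<open>b\<close>, which the cell \<open>(1, b + 1)\<close> detects.\<close>

lemma rows_filled_below1:
  assumes "1 \<le> a" "1 \<le> j" "j \<le> n"
  shows "(\<forall>y\<in>rows a b c d. y < (1, j) \<longrightarrow> {y<..<(1, j)} \<inter> two_by n \<subseteq> rows a b c d) \<longleftrightarrow>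
    (a \<le> b \<longrightarrow> j \<le> a \<or> j \<le> b + 1)" (is "?L \<longleftrightarrow> ?R")
proof
  assume L: ?L
  show ?R
  proof (rule ccontr)
    assume n: "\<not> ?R"
    then have "(1, b + 1) \<in> {(1, b)<..<(1, j)} \<inter> two_by n" "(1, b) \<in> rows a b c d" "(1::nat, b) < (1, j)"
      using assms by (auto simp: prod_less_iff two_by_def rows_def)
    with L have "(1, b + 1) \<in> rows a b c d" by blast
    then show False by (auto simp: rows_def)
  qed
next
  assume ?R
  then show ?L using assms by (auto simp: prod_less_iff two_by_def rows_def)
qed

text \<open>In the lower row the first cell makes the strongest demand: between
  \<open>(1, a)\<close> and \<open>(2, j)\<close> lie \<open>(1, i)\<close> for
  \<open>a < i \<le> j\<close> and \<open>(2, i)\<close> for \<open>a \<le> i < j\<close>.\<close>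

lemma rows_filled_below2:
  assumes "1 \<le> a" "1 \<le> c" "1 \<le> j" "j \<le> n"
  shows "(\<forall>y\<in>rows a b c d. y < (2, j) \<longrightarrow> {y<..<(2, j)} \<inter> two_by n \<subseteq> rows a b c d) \<longleftrightarrow>
    (c \<le> d \<longrightarrow> j \<le> c \<or> j \<le> d + 1) \<and>
    (a \<le> b \<and> a \<le> j \<longrightarrow> j \<le> b \<and> (j = a \<or> c \<le> a \<and> j \<le> d + 1))" (is "?L \<longleftrightarrow> ?R")
proof
  assume L: ?L
  have mem: "z \<in> rows a b c d" if "y \<in> rows a b c d" "y < z" "z < (2, j)" "z \<in> two_by n" for y z
  proof -
    have "y < (2, j)" using that order.strict_trans by blast
    then have "{y<..<(2, j)} \<inter> two_by n \<subseteq> rows a b c d" using L that(1) by blast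
    then show ?thesis using that by auto
  qed
  have 1: "j \<le> c \<or> j \<le> d + 1" if "c \<le> d"
    using mem[of "(2, d)" "(2, d + 1)"] assms that by (auto simp: prod_less_iff two_by_def rows_def)
  have 2: "j \<le> b \<and> (j = a \<or> c \<le> a \<and> j \<le> d + 1)" if "a \<le> b" "a \<le> j"
  proof -
    have "j \<le> b"
      using mem[of "(1, b)" "(1, b + 1)"] assms that
      by (cases "b < j") (auto simp: prod_less_iff two_by_def rows_def)
    moreover have "c \<le> a \<and> a \<le> d" if "j \<noteq> a"
      using mem[of "(1, a)" "(2, a)"] assms that \<open>a \<le> b\<close> \<open>a \<le> j\<close>
      by (auto simp: prod_less_iff two_by_def rows_def)
    ultimately show ?thesis using 1 by linarith
  qed
  show ?R using 1 2 by blast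
next
  assume ?R
  then show ?L using assms by (auto simp: prod_less_iff two_by_def rows_def)
qed

text \<open>This is \<open>rows_filled_below1\<close> under the order reversal that sends
  \<open>(i, j)\<close> to \<open>(3 - i, n + 1 - j)\<close>.\<close>

lemma rows_filled_above2:
  assumes "d \<le> n" "1 \<le> j" "j \<le> n"
  shows "(\<forall>y\<in>rows a b c d. (2, j) < y \<longrightarrow> {(2, j)<..<y} \<inter> two_by n \<subseteq> rows a b c d) \<longleftrightarrow>
    (c \<le> d \<longrightarrow> d \<le> j \<or> c \<le> j + 1)" (is "?L \<longleftrightarrow> ?R")
proof
  assume L: ?L
  show ?R
  proof (rule ccontr)
    assume n: "\<not> ?R"
    then have "(2, j + 1) \<in> {(2, j)<..<(2, c)} \<inter> two_by n" "(2, c) \<in> rows a b c d" "(2::nat, j) < (2, c)"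
      using assms by (auto simp: prod_less_iff two_by_def rows_def)
    with L have "(2, j + 1) \<in> rows a b c d" by blast
    then show False using n by (auto simp: rows_def)
  qed
next
  assume ?R
  then show ?L using assms by (auto simp: prod_less_iff two_by_def rows_def)
qed

text \<open>Dual to \<open>rows_filled_below2\<close>; the decisive upper cell is the last one,
  \<open>(2, d)\<close>.\<close>

lemma rows_filled_above1:
  assumes "b \<le> n" "d \<le> n" "1 \<le> j" "j \<le> n"
  shows "(\<forall>y\<in>rows a b c d. (1, j) < y \<longrightarrow> {(1, j)<..<y} \<inter> two_by n \<subseteq> rows a b c d) \<longleftrightarrow>
    (a \<le> b \<longrightarrow> b \<le> j \<or> a \<le> j + 1) \<and>
    (c \<le> d \<and> j \<le> d \<longrightarrow> c \<le> j \<and> (j = d \<or> a \<le> j + 1 \<and> d \<le> b))" (is "?L \<longleftrightarrow> ?R")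
proof
  assume L: ?L
  have mem: "z \<in> rows a b c d" if "y \<in> rows a b c d" "z < y" "(1, j) < z" "z \<in> two_by n" for y z
  proof -
    have "(1, j) < y" using that order.strict_trans by blast
    then have "{(1, j)<..<y} \<inter> two_by n \<subseteq> rows a b c d" using L that(1) by blast
    then show ?thesis using that by auto
  qed
  have 1: "b \<le> j \<or> a \<le> j + 1" if "a \<le> b"
    using mem[of "(1, a)" "(1, j + 1)"] assms that by (auto simp: prod_less_iff two_by_def rows_def)
  have 2: "c \<le> j \<and> (j = d \<or> a \<le> j + 1 \<and> d \<le> b)" if "c \<le> d" "j \<le> d"
  proof -
    have "c \<le> j"
      using mem[of "(2, c)" "(2, j)"] assms that
      by (cases "j < c") (auto simp: prod_less_iff two_by_def rows_def)
    moreover have "a \<le> d \<and> d \<le> b" if "j \<noteq> d"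
      using mem[of "(2, d)" "(1, d)"] assms that \<open>c \<le> d\<close> \<open>j \<le> d\<close>
      by (auto simp: prod_less_iff two_by_def rows_def)
    ultimately show ?thesis using 1 assms that by linarith
  qed
  show ?R using 1 2 by blast
next
  assume ?R
  then show ?L using assms by (auto simp: prod_less_iff two_by_def rows_def)
qed

text \<open>Turns \<open>rowmotion_eqI\<close> into linear arithmetic in the column
  \<open>j\<close>. The new bounds occur on both sides because a cell depends on the new status of
  the cells above it: a proposed result is verified, not computed.\<close>

lemma row_step:
  assumes lin: "linear_extension (two_by n) xs" and I: "rows a b c d \<in> ICS (two_by n)"
    and bnd: "1 \<le> a" "b \<le> n" "1 \<le> c" "d \<le> n" "1 \<le> a'" "b' \<le> n" "1 \<le> c'" "d' \<le> n"
    and top: "\<And>j. 1 \<le> j \<Longrightarrow> j \<le> n \<Longrightarrow> c' \<le> j \<and> j \<le> d' \<longleftrightarrow>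
      (if c \<le> j \<and> j \<le> d then (a \<le> b \<and> a \<le> j \<or> c \<le> d \<and> c < j) \<and> (c' \<le> d' \<and> j < d')
       else (c \<le> d \<longrightarrow> j \<le> c \<or> j \<le> d + 1) \<and>
            (a \<le> b \<and> a \<le> j \<longrightarrow> j \<le> b \<and> (j = a \<or> c \<le> a \<and> j \<le> d + 1)) \<and>
            (c' \<le> d' \<longrightarrow> d' \<le> j \<or> c' \<le> j + 1))"
    and bot: "\<And>j. 1 \<le> j \<Longrightarrow> j \<le> n \<Longrightarrow> a' \<le> j \<and> j \<le> b' \<longleftrightarrow>
      (if a \<le> j \<and> j \<le> b then (a \<le> b \<and> a < j) \<and> (a' \<le> b' \<and> j < b' \<or> c' \<le> d' \<and> j \<le> d')
       else (a \<le> b \<longrightarrow> j \<le> a \<or> j \<le> b + 1) \<and>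
            (a' \<le> b' \<longrightarrow> b' \<le> j \<or> a' \<le> j + 1) \<and>
            (c' \<le> d' \<and> j \<le> d' \<longrightarrow> c' \<le> j \<and> (j = d' \<or> a' \<le> j + 1 \<and> d' \<le> b')))"
  shows "rowmotion (two_by n) xs (rows a b c d) = rows a' b' c' d'"
proof (rule rowmotion_eqI[OF lin I])
  show "rows a' b' c' d' \<subseteq> two_by n" using bnd by (auto simp: rows_def two_by_def)
  fix x assume "x \<in> two_by n"
  then consider j where "x = (1, j)" "1 \<le> j" "j \<le> n" | j where "x = (2, j)" "1 \<le> j" "j \<le> n"
    by (auto simp: two_by_def)
  then show "x \<in> rows a' b' c' d' \<longleftrightarrow>
      (if x \<in> rows a b c d then (\<exists>y\<in>rows a b c d. y < x) \<and> (\<exists>y\<in>rows a' b' c' d'. x < y)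
       else (\<forall>y\<in>rows a b c d. y < x \<longrightarrow> {y<..<x} \<inter> two_by n \<subseteq> rows a b c d) \<and>
            (\<forall>y\<in>rows a' b' c' d'. x < y \<longrightarrow> {x<..<y} \<inter> two_by n \<subseteq> rows a' b' c' d'))"
  proof cases
    case 1
    have mem: "(1, j) \<in> rows p q r s \<longleftrightarrow> p \<le> j \<and> j \<le> q" for p q r s by (auto simp: rows_def)
    show ?thesis
      unfolding 1(1) mem rows_below1 rows_above1 rows_filled_below1[OF bnd(1) 1(2,3)]
        rows_filled_above1[OF bnd(6,8) 1(2,3)] bot[OF 1(2,3)] by (rule refl)
  next
    case 2
    have mem: "(2, j) \<in> rows p q r s \<longleftrightarrow> r \<le> j \<and> j \<le> s" for p q r s by (auto simp: rows_def)
    show ?thesis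
      unfolding 2(1) mem rows_below2 rows_above2 rows_filled_below2[OF bnd(1,3) 2(2,3)]
        rows_filled_above2[OF bnd(8) 2(2,3)] top[OF 2(2,3)] by (simp only: conj_assoc)
  qed
qed

section \<open>Triples and their rotation\<close>

text \<open>A triple stands for the segment with first column \<open>x\<close> and length
  \<open>y\<close>; \<open>z\<close> is four more than the number of cells to its right. This shift
  makes the constraints invariant under rotation.\<close>

definition triples :: "nat \<Rightarrow> (nat \<times> nat \<times> nat) set" where
  "triples n = {(x, y, z). 4 \<le> x \<and> 4 \<le> y \<and> 4 \<le> z \<and> x + y + z = n + 5}"

lemma card_triples:
  assumes "7 \<le> n"
  shows "card (triples n) = (n - 5) choose 2"
proof -
  have "bij_betw (\<lambda>(x, y, z). (x, y)) (triples n) (SIGMA x:{4..n - 3}. {4..n + 1 - x})"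
    by (rule bij_betw_byWitness[where f' = "\<lambda>(x, y). (x, y, n + 5 - x - y)"])
      (use assms in \<open>auto simp: triples_def\<close>)
  from bij_betw_same_card[OF this] have "card (triples n) = (\<Sum>x = 4..n - 3. n - 2 - x)"
    by simp
  also have "\<dots> = (\<Sum>i = 1..n - 6. i)"
    by (rule sum.reindex_bij_witness[of _ "\<lambda>i. n - 2 - i" "\<lambda>x. n - 2 - x"]) (use assms in auto)
  also have "\<dots> = (n - 5) choose 2"
  proof -
    obtain m where "n = m + 7" using assms by (metis add.commute le_Suc_ex)
    then show ?thesis
      using gauss_sum_from_Suc_0[of "n - 6", where 'a = nat] by (simp add: choose_two)
  qed
  finally show ?thesis .
qed

lemma finite_triples: "finite (triples n)"
  by (rule finite_subset[of _ "{..n + 5} \<times> {..n + 5} \<times> {..n + 5}"]) (auto simp: triples_def)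

fun rot :: "nat \<times> nat \<times> nat \<Rightarrow> nat \<times> nat \<times> nat" where
  "rot (x, y, z) = (z, x, y)"

lemma rot_fixed_iff: "rot (x, y, z) = (x, y, z) \<longleftrightarrow> y = x \<and> z = x"
  unfolding rot.simps prod.inject by blast

section \<open>Single rowmotion steps on two rows\<close>

locale two_row_poset =
  fixes n :: nat and xs :: "(nat \<times> nat) list"
  assumes lin: "linear_extension (two_by n) xs"
begin

abbreviation "row \<equiv> rowmotion (two_by n) xs"
abbreviation "ics \<equiv> ICS (two_by n)"

text \<open>The cells \<open>(2, j)\<close> with \<open>j \<le> a\<close> enter, as at most
  \<open>(1, a)\<close> lies below them; further right the missing \<open>(2, a)\<close> blocks. In
  the lower row the first cell leaves and \<open>(1, b + 1)\<close> enters.\<close>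

lemma row_first:
  assumes "rows a b 1 0 \<in> ics" "1 \<le> a" "a < b" "b < n"
  shows "row (rows a b 1 0) = rows (a + 1) (b + 1) 1 a"
  by (rule row_step[OF lin assms(1)]; use assms(2-) in auto)

text \<open>The relation \<open>d + 1 = a\<close> holds again afterwards, so the step can be
  repeated until the lower row reaches column \<open>n\<close>.\<close>

lemma row_slide:
  assumes "rows a b c d \<in> ics" "1 \<le> c" "c < d" "d + 1 = a" "a < b" "b < n"
  shows "row (rows a b c d) = rows (a + 1) (b + 1) (c + 1) (d + 1)"
  by (rule row_step[OF lin assms(1)]; use assms(2-) in auto)

text \<open>No cell can be added behind \<open>(1, n)\<close>, so it has nothing above it and
  leaves; the cells before it then leave one after another.\<close>

lemma row_first_end:
  assumes "rows a n 1 0 \<in> ics" "1 \<le> a" "a < n"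
  shows "row (rows a n 1 0) = rows 1 0 1 a"
  by (rule row_step[OF lin assms(1)]; use assms(2-) in auto)

lemma row_end:
  assumes "rows a n c d \<in> ics" "1 \<le> c" "c < d" "d + 1 = a" "a < n"
  shows "row (rows a n c d) = rows 1 0 (c + 1) a"
  by (rule row_step[OF lin assms(1)]; use assms(2-) in auto)

text \<open>The lower row fills up from its right end, and stops before column \<open>c\<close>
  because \<open>(2, c)\<close> has just left.\<close>

lemma row_lower_empty:
  assumes "rows 1 0 c d \<in> ics" "1 \<le> c" "c < d" "d < n"
  shows "row (rows 1 0 c d) = rows (c + 1) n (c + 1) (d + 1)"
  by (rule row_step[OF lin assms(1)]; use assms(2-) in auto)

text \<open>Lower cells right of column \<open>d + 1\<close> have nothing above them and leave,
  starting at column \<open>n\<close>; upper cells left of \<open>c\<close> have nothing below them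
  and enter.\<close>

lemma row_aligned:
  assumes "rows c n c d \<in> ics" "1 < c" "c < d" "d + 1 < n"
  shows "row (rows c n c d) = rows (c + 1) (d + 1) 1 (d + 1)"
  by (rule row_step[OF lin assms(1)]; use assms(2-) in auto)

text \<open>The missing \<open>(1, b + 1)\<close> keeps \<open>(2, b + 1)\<close> out, so
  \<open>(2, b)\<close> is maximal and the upper row empties from its right end.\<close>

lemma row_upper_full:
  assumes "rows a b 1 b \<in> ics" "1 < a" "a < b" "b < n"
  shows "row (rows a b 1 b) = rows (a + 1) (b + 1) 1 0"
  by (rule row_step[OF lin assms(1)]; use assms(2-) in auto)

section \<open>Iterated rowmotion on segments of the lower row\<close>

text \<open>The coordinate \<open>z\<close> does not affect the set; the bounds 1 and 0 give an empty upper row.\<close>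

definition seg :: "nat \<times> nat \<times> nat \<Rightarrow> (nat \<times> nat) set" where
  "seg = (\<lambda>(x, y, z). rows x (x + y - 1) 1 0)"

lemma seg_in_ICS:
  assumes "t \<in> triples n"
  shows "seg t \<in> ics"
  using assms by (auto simp: seg_def triples_def ICS_def rows_def two_by_def)

lemma funpow_row_in_ICS: "I \<in> ics \<Longrightarrow> (row ^^ k) I \<in> ics"
  by (induction k) (auto intro: rowmotion_in_ICS)

text \<open>The bound \<open>k + 5 \<le> z\<close> says that the last column
  \<open>x + k + y\<close> of the lower segment is at most \<open>n\<close>.\<close>

lemma funpow_row_slide:
  assumes "(x, y, z) \<in> triples n" "k + 5 \<le> z"
  shows "(row ^^ Suc k) (seg (x, y, z)) = rows (x + k + 1) (x + k + y) (k + 1) (x + k)"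
  using assms(2)
proof (induction k)
  case 0
  then show ?case
    using row_first[of x "x + y - 1"] assms(1) seg_in_ICS[OF assms(1)]
    by (auto simp: seg_def triples_def)
next
  case (Suc k)
  have "(row ^^ Suc k) (seg (x, y, z)) \<in> ics"
    by (rule funpow_row_in_ICS[OF seg_in_ICS[OF assms(1)]])
  with Suc row_slide[of "x + k + 1" "x + k + y" "k + 1" "x + k"] show ?case
    using assms(1) by (auto simp: triples_def)
qed

lemma funpow_row_seg:
  assumes t: "(x, y, z) \<in> triples n"
  shows "(row ^^ (z - 3)) (seg (x, y, z)) = rows 1 0 (z - 3) (x + z - 4)" (is ?A)
    and "(row ^^ (z - 2)) (seg (x, y, z)) = rows (z - 2) n (z - 2) (x + z - 3)" (is ?B)
    and "(row ^^ (z - 1)) (seg (x, y, z)) = rows (z - 1) (x + z - 2) 1 (x + z - 2)" (is ?C)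
    and "(row ^^ z) (seg (x, y, z)) = seg (z, x, y)" (is ?D)
proof -
  \<comment> \<open>\<open>w\<close> counts the cells to the right of the segment, so the lower
    segment meets the end of its row after \<open>w\<close> steps.\<close>
  obtain w where z: "z = w + 4" and xy: "x \<ge> 4" "y \<ge> 4" "x + y + w = n + 1"
    using t by (auto simp: triples_def intro: that[of "z - 4"])
  have I: "(row ^^ k) (seg (x, y, z)) \<in> ics" for k
    by (rule funpow_row_in_ICS[OF seg_in_ICS[OF t]])
  have A: "(row ^^ (w + 1)) (seg (x, y, z)) = rows 1 0 (w + 1) (x + w)"
  \<comment> \<open>For \<open>w = 0\<close> the segment ends at column \<open>n\<close> from the
    start, and the upper row is created in the same step that empties the lower one.\<close>
  proof (cases w)
    case 0
    then show ?thesis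
      using row_first_end[of x] I[of 0] xy by (auto simp: seg_def)
  next
    case (Suc v)
    have "x + v + y = n" using Suc xy by simp
    then have "(row ^^ w) (seg (x, y, z)) = rows (x + w) n w (x + v)"
      using funpow_row_slide[OF t, of v] Suc z by simp
    then show ?thesis using row_end[of "x + w" w "x + v"] I[of w] Suc xy by simp
  qed
  have B: "(row ^^ (w + 2)) (seg (x, y, z)) = rows (w + 2) n (w + 2) (x + w + 1)"
    using row_lower_empty[of "w + 1" "x + w"] A I[of "w + 1"] xy by simp
  \<comment> \<open>Here \<open>y \<ge> 4\<close> enters: it gives \<open>x + w + 2 < n\<close>, on
    which this step and the next depend.\<close>
  have C: "(row ^^ (w + 3)) (seg (x, y, z)) = rows (w + 3) (x + w + 2) 1 (x + w + 2)"
    using row_aligned[of "w + 2" "x + w + 1"] B I[of "w + 2"] xy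
    by (simp add: numeral_3_eq_3)
  have D: "(row ^^ (w + 4)) (seg (x, y, z)) = rows (w + 4) (x + w + 3) 1 0"
    using row_upper_full[of "w + 3" "x + w + 2"] C I[of "w + 3"] xy
    by (simp add: eval_nat_numeral)
  show ?A ?B ?C ?D using A B C D by (auto simp: z seg_def add.commute add.left_commute)
qed

lemma funpow_row_seg_ne:
  assumes t: "(x, y, z) \<in> triples n" and k: "0 < k" "k < z"
  shows "(row ^^ k) (seg (x, y, z)) \<noteq> seg t'"
proof -
  have xyz: "4 \<le> x" "4 \<le> y" "4 \<le> z" using t by (auto simp: triples_def)
  \<comment> \<open>Times up to \<open>z - 4\<close> belong to the slide; three transitional states
    remain.\<close>
  have "k = Suc (k - 1) \<and> k - 1 + 5 \<le> z \<or> k = z - 3 \<or> k = z - 2 \<or> k = z - 1" using k by arith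
  then obtain a b c d where st: "(row ^^ k) (seg (x, y, z)) = rows a b c d" "c \<le> d"
  proof (elim disjE conjE)
    assume "k = Suc (k - 1)" "k - 1 + 5 \<le> z"
    then show ?thesis using that[of _ _ "k - 1 + 1" "x + (k - 1)"] funpow_row_slide[OF t, of "k - 1"] xyz by simp
  next
    assume "k = z - 3"
    then show ?thesis using that funpow_row_seg(1)[OF t] xyz by simp
  next
    assume "k = z - 2"
    then show ?thesis using that funpow_row_seg(2)[OF t] xyz by simp
  next
    assume "k = z - 1"
    then show ?thesis using that funpow_row_seg(3)[OF t] xyz by simp
  qed
  then have "(2, c) \<in> (row ^^ k) (seg (x, y, z))" by (simp add: st rows_def)
  moreover have "(2, c) \<notin> seg t'" by (auto simp: seg_def rows_def split: prod.split)
  ultimately show ?thesis by blast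
qed

text \<open>The \<open>n + 5\<close> steps split into passages of lengths \<open>z\<close>,
  \<open>y\<close> and \<open>x\<close>, starting at \<open>(x, y, z)\<close>,
  \<open>(z, x, y)\<close> and \<open>(y, z, x)\<close>; inside each passage the upper row is
  nonempty.\<close>

lemma funpow_row_cases:
  assumes t: "(x, y, z) \<in> triples n" and k: "k < n + 5" and eq: "(row ^^ k) (seg (x, y, z)) = seg t'"
  shows "k = 0 \<or> k = z \<or> k = z + y"
proof (rule ccontr)
  assume n: "\<not> ?thesis"
  have t2: "(z, x, y) \<in> triples n" and t3: "(y, z, x) \<in> triples n"
    using t by (auto simp: triples_def)
  have *: "(row ^^ (i + z)) (seg (x, y, z)) = (row ^^ i) (seg (z, x, y))" for i
    using funpow_row_seg(4)[OF t] by (simp add: funpow_add)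
  have **: "(row ^^ (i + y + z)) (seg (x, y, z)) = (row ^^ i) (seg (y, z, x))" for i
    using funpow_row_seg(4)[OF t2] *[of "i + y"] by (simp add: funpow_add)
  consider "0 < k" "k < z" | "0 < k - z" "k - z < y" "k = k - z + z"
    | "0 < k - z - y" "k - z - y < x" "k = k - z - y + y + z"
    using n k t by (fastforce simp: triples_def)
  then show False
  proof cases
    case 1
    then show False using funpow_row_seg_ne[OF t] eq by blast
  next
    case 2
    then show False using funpow_row_seg_ne[OF t2 2(1,2)] eq *[of "k - z"] by metis
  next
    case 3
    then show False using funpow_row_seg_ne[OF t3 3(1,2)] eq **[of "k - z - y"] by metis
  qed
qed

lemma rot_in_triples: "t \<in> triples n \<Longrightarrow> rot t \<in> triples n"
  by (cases t) (auto simp: triples_def)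

lemma funpow_row_rot:
  assumes t: "(x, y, z) \<in> triples n"
  shows "(row ^^ (z + y)) (seg (x, y, z)) = seg (y, z, x)"
    and "(row ^^ (n + 5)) (seg (x, y, z)) = seg (x, y, z)"
proof -
  have t2: "(z, x, y) \<in> triples n" and t3: "(y, z, x) \<in> triples n" and "n + 5 = x + (y + z)"
    using t by (auto simp: triples_def)
  then show "(row ^^ (z + y)) (seg (x, y, z)) = seg (y, z, x)"
    "(row ^^ (n + 5)) (seg (x, y, z)) = seg (x, y, z)"
    using funpow_row_seg(4)[OF t] funpow_row_seg(4)[OF t2] funpow_row_seg(4)[OF t3]
    by (simp_all add: funpow_add add.commute[of z y] del: funpow.simps)
qed

section \<open>Membership in the orbits of segments, and their sizes\<close>

text \<open>A nonempty segment determines its first column and its length; the fixed sum then gives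
  \<open>z\<close>.\<close>

lemma seg_inj: "inj_on seg (triples n)"
proof (rule inj_onI)
  fix s t assume st: "s \<in> triples n" "t \<in> triples n" "seg s = seg t"
  obtain x y z x' y' z' where s: "s = (x, y, z)" and t: "t = (x', y', z')" by (cases s, cases t)
  have b: "4 \<le> x" "4 \<le> y" "4 \<le> x'" "4 \<le> y'" "x + y + z = x' + y' + z'"
    using st by (auto simp: s t triples_def)
  have "j \<in> {x..<x + y} \<longleftrightarrow> j \<in> {x'..<x' + y'}" for j
  proof -
    have "(1, j) \<in> seg s \<longleftrightarrow> (1, j) \<in> seg t" using st by simp
    then show ?thesis using b by (auto simp: seg_def rows_def s t)
  qed
  then have "{x..<x + y} = {x'..<x' + y'}" by blast
  then show "s = t" using b by (auto simp: s t atLeastLessThan_eq_iff)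
qed

text \<open>The first \<open>n + 5\<close> iterates exhaust the orbit and can be segments only at
  the times 0, \<open>z\<close> and \<open>z + y\<close>; injectivity of \<open>seg\<close> carries
  this over to triples.\<close>

lemma orbit_seg_mem_iff:
  assumes t: "t \<in> triples n" and t': "t' \<in> triples n"
  shows "seg t' \<in> orbit row (seg t) \<longleftrightarrow> t' = t \<or> t' = rot t \<or> t' = rot (rot t)"
proof -
  obtain x y z where xyz: "t = (x, y, z)" by (cases t)
  have t2: "(z, x, y) \<in> triples n" and t3: "(y, z, x) \<in> triples n"
    and t1: "(x, y, z) \<in> triples n" and sum: "n + 5 = x + y + z" and pos: "0 < x" "0 < y"
    using t by (auto simp: xyz triples_def)
  have orb: "orbit row (seg t) = (\<lambda>k. (row ^^ k) (seg t)) ` {..<n + 5}"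
    using orbit_eq_funpow_image[of "n + 5" row "seg t"] funpow_row_rot(2)[OF t1] by (simp add: xyz)
  note hit = funpow_row_rot(1)[OF t1] funpow_row_seg(4)[OF t1]
  have seg_orbit: "seg t'' \<in> orbit row (seg t)" if "(row ^^ k) (seg (x, y, z)) = seg t''" "k < n + 5" for k t''
    unfolding orb using that by (intro image_eqI[of _ _ k]) (simp_all add: xyz)
  show ?thesis
  proof
    assume "seg t' \<in> orbit row (seg t)"
    then have "seg t' \<in> (\<lambda>k. (row ^^ k) (seg t)) ` {..<n + 5}" by (simp only: orb)
    then obtain k where k: "k < n + 5" "(row ^^ k) (seg (x, y, z)) = seg t'"
      unfolding xyz by (elim imageE) simp
    from funpow_row_cases[OF t1 this] consider "k = 0" | "k = z" | "k = z + y" by blast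
    then have "seg (x, y, z) = seg t' \<or> seg (z, x, y) = seg t' \<or> seg (y, z, x) = seg t'"
      by cases (use k(2) hit in simp_all)
    then have "(x, y, z) = t' \<or> (z, x, y) = t' \<or> (y, z, x) = t'"
      using inj_onD[OF seg_inj _ _ t'] t1 t2 t3 by blast
    then show "t' = t \<or> t' = rot t \<or> t' = rot (rot t)" by (auto simp: xyz)
  next
    assume "t' = t \<or> t' = rot t \<or> t' = rot (rot t)"
    then consider "t' = (x, y, z)" | "t' = (z, x, y)" | "t' = (y, z, x)" by (auto simp: xyz)
    then show "seg t' \<in> orbit row (seg t)"
    proof cases
      case 1
      then show ?thesis using seg_orbit[of 0 t'] by simp
    next
      case 2
      then show ?thesis using seg_orbit[OF hit(2)] sum pos by simp
    next
      case 3
      then show ?thesis using seg_orbit[OF hit(1)] sum pos by simp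
    qed
  qed
qed

text \<open>A return before time \<open>n + 5\<close> happens at \<open>z\<close> or
  \<open>z + y\<close> and equates the triple with a proper rotation of itself; either equality
  forces \<open>x = y = z\<close>.\<close>

lemma card_orbit_seg:
  assumes t: "t \<in> triples n"
  shows "card (orbit row (seg t)) = (if rot t = t then (n + 5) div 3 else n + 5)"
proof -
  obtain x y z where xyz: "t = (x, y, z)" by (cases t)
  have t2: "(z, x, y) \<in> triples n" and t3: "(y, z, x) \<in> triples n"
    and t1: "(x, y, z) \<in> triples n" and sum: "n + 5 = x + y + z" and pos: "0 < z"
    using t by (auto simp: xyz triples_def)
  show ?thesis
  proof (cases "rot t = t")
    case True
    then have eq: "y = x" "z = x" unfolding xyz rot_fixed_iff by blast+
    \<comment> \<open>With equal coordinates the first passage is already a return; the nonempty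
      upper row excludes an earlier one.\<close>
    have "card (orbit row (seg (x, x, x))) = x"
      using t1 funpow_row_seg(4)[of x x x] funpow_row_seg_ne[of x x x] pos unfolding eq
      by (intro card_orbit_eq_period) blast+
    then show ?thesis using True sum unfolding xyz eq by simp
  next
    case False
    have "card (orbit row (seg t)) = n + 5"
    proof (rule card_orbit_eq_period)
      show "(row ^^ (n + 5)) (seg t) = seg t" using funpow_row_rot(2)[OF t1] by (simp add: xyz)
      fix k assume k: "0 < k" "k < n + 5"
      show "(row ^^ k) (seg t) \<noteq> seg t"
      proof
        assume eq: "(row ^^ k) (seg t) = seg t"
        then have eq': "(row ^^ k) (seg (x, y, z)) = seg t" by (simp only: xyz)
        then consider "k = z" | "k = z + y" using funpow_row_cases[OF t1 k(2)] k(1) by blast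
        then have "seg t = seg (z, x, y) \<or> seg t = seg (y, z, x)"
        proof cases
          case 1
          then show ?thesis using eq' funpow_row_seg(4)[OF t1] by argo
        next
          case 2
          then show ?thesis using eq' funpow_row_rot(1)[OF t1] by argo
        qed
        then have "t = (z, x, y) \<or> t = (y, z, x)" using inj_onD[OF seg_inj _ t] t2 t3 by blast
        then show False using False unfolding xyz rot_fixed_iff by blast
      qed
    qed simp
    with False show ?thesis by simp
  qed
qed

section \<open>Counting the orbits\<close>

text \<open>Each of these orbits comes from exactly three triples, the rotations of one triple,
  which are distinct because \<open>rot\<close> does not fix it.\<close>

lemma three_times_card_orbits:
  "3 * card ((\<lambda>t. orbit row (seg t)) ` {t \<in> triples n. rot t \<noteq> t}) = card {t \<in> triples n. rot t \<noteq> t}"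
proof -
  let ?T = "{t \<in> triples n. rot t \<noteq> t}" and ?O = "\<lambda>t. orbit row (seg t)"
  have fin: "finite ?T" using finite_triples by simp
  have eq: "?O t' = ?O t \<longleftrightarrow> t' = t \<or> t' = rot t \<or> t' = rot (rot t)"
    if "t \<in> triples n" "t' \<in> triples n" for t t'
  proof -
    have "?O t' = ?O t \<longleftrightarrow> seg t' \<in> ?O t"
    proof
      assume "?O t' = ?O t"
      then show "seg t' \<in> ?O t" using orbit_seg_mem_iff[OF that(2,2)] by simp
    next
      assume "seg t' \<in> ?O t"
      \<comment> \<open>That \<open>seg t\<close> lies in its own orbit is the premise under which
        \<open>orbit_swap\<close> reverses membership.\<close>
      moreover have "seg t \<in> ?O t" using orbit_seg_mem_iff[OF that(1,1)] by simp
      ultimately show "?O t' = ?O t" by (meson orbit_swap orbit_trans subsetI subset_antisym)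
    qed
    then show ?thesis using orbit_seg_mem_iff[OF that] by simp
  qed
  have "card {t' \<in> ?T. ?O t' = R} = 3" if R: "R \<in> ?O ` ?T" for R
  proof -
    obtain t where t: "t \<in> ?T" "R = ?O t" using R by blast
    obtain x y z where xyz: "t = (x, y, z)" by (cases t)
    have "{t' \<in> ?T. ?O t' = R} = {t, rot t, rot (rot t)}"
    proof -
      have rot3: "rot (rot (rot t)) = t" by (simp add: xyz)
      then have free: "rot t' \<noteq> t'" if "t' = t \<or> t' = rot t \<or> t' = rot (rot t)" for t'
        using t(1) that by (metis (mono_tags, lifting) mem_Collect_eq)
      have tt: "t \<in> triples n" using t(1) by simp
      then have mem: "t' \<in> triples n" if "t' = t \<or> t' = rot t \<or> t' = rot (rot t)" for t'
        using that rot_in_triples[of t] rot_in_triples[of "rot t"] by blast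
      have "t' \<in> ?T \<and> ?O t' = R \<longleftrightarrow> t' = t \<or> t' = rot t \<or> t' = rot (rot t)" for t'
        unfolding t(2) mem_Collect_eq using free[of t'] mem[of t'] eq[OF tt, of t'] by argo
      then show ?thesis by blast
    qed
    moreover have "card {t, rot t, rot (rot t)} = 3"
    proof -
      have "rot t \<noteq> t" "rot (rot t) \<noteq> rot t" "rot (rot t) \<noteq> t"
        using t(1) unfolding xyz rot.simps prod.inject mem_Collect_eq by blast+
      then show ?thesis by (simp add: card_insert_if eq_commute)
    qed
    ultimately show ?thesis by simp
  qed
  then show ?thesis
    using sum.image_gen[OF fin, of "\<lambda>_. 1::nat" ?O] by simp
qed

lemma seg_eq_block: "4 \<le> x \<Longrightarrow> 4 \<le> y \<Longrightarrow> seg (x, y, z) = block (x - 1) y a"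
  by (auto simp: seg_def rows_def block_def)

text \<open>A fixed triple is \<open>(x, x, x)\<close> with \<open>3 * x = n + 5\<close>; it exists
  exactly when \<open>n mod 3 = 1\<close>, and then \<open>n \<ge> 7\<close> ensures
  \<open>x \<ge> 4\<close>.\<close>

lemma card_nondegenerate:
  assumes "7 \<le> n"
  shows "card {t \<in> triples n. rot t \<noteq> t} = ((n - 5) choose 2) - (if n mod 3 = 1 then 1 else 0)"
proof -
  have deg: "{t \<in> triples n. rot t = t} =
      (if n mod 3 = 1 then {((n + 5) div 3, (n + 5) div 3, (n + 5) div 3)} else {})"
  proof -
    have "3 * x = n + 5 \<longleftrightarrow> n mod 3 = 1 \<and> x = (n + 5) div 3" for x by presburger
    moreover have "4 \<le> x" if "3 * x = n + 5" for x using that assms by simp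
    moreover have "{t \<in> triples n. rot t = t} = {(x, x, x) | x. 4 \<le> x \<and> 3 * x = n + 5}"
    proof -
      have "rot t = t \<longleftrightarrow> (\<exists>x. t = (x, x, x))" for t
        by (cases t) (auto simp: rot_fixed_iff simp del: rot.simps)
      then show ?thesis by (auto simp: triples_def)
    qed
    ultimately show ?thesis by auto
  qed
  have "{t \<in> triples n. rot t \<noteq> t} = triples n - {t \<in> triples n. rot t = t}" by blast
  then have "card {t \<in> triples n. rot t \<noteq> t} = card (triples n) - card {t \<in> triples n. rot t = t}"
    using finite_triples[of n] by (simp add: card_Diff_subset)
  then show ?thesis using card_triples[OF assms] by (simp add: deg)
qed

definition long_orbits :: "(nat \<times> nat) set set set" where
  "long_orbits = (\<lambda>t. orbit row (seg t)) ` {t \<in> triples n. rot t \<noteq> t}"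

lemma long_orbits:
  shows "long_orbits \<subseteq> rowmotion_orbits (two_by n) xs" "finite long_orbits"
    and "\<And>R. R \<in> long_orbits \<Longrightarrow> card R = n + 5"
  using seg_in_ICS finite_triples card_orbit_seg
  by (auto simp: long_orbits_def rowmotion_orbits_def)

text \<open>The second alternative covers the triple fixed by \<open>rot\<close>, whose orbit is
  shorter.\<close>

lemma block_in_orbit:
  assumes "4 \<le> x" "4 \<le> y" "x + y \<le> n + 1"
  shows "block (x - 1) y a \<in> \<Union>long_orbits \<or>
    x = y \<and> 3 * x = n + 5 \<and> block (x - 1) y a \<in> orbit row (seg (x, y, x))"
proof -
  \<comment> \<open>\<open>x + y \<le> n + 1\<close> is exactly the condition that this third
    coordinate is at least 4.\<close>
  define t where "t = (x, y, n + 5 - x - y)"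
  have t: "t \<in> triples n" using assms by (auto simp: t_def triples_def)
  have "block (x - 1) y a \<in> orbit row (seg t)"
    using orbit_seg_mem_iff[OF t t] unfolding t_def seg_eq_block[OF assms(1,2), of _ a] by blast
  moreover have "orbit row (seg t) \<in> long_orbits" if "rot t \<noteq> t"
    using t that by (auto simp: long_orbits_def)
  moreover have "x = y \<and> 3 * x = n + 5 \<and> t = (x, y, x)" if "rot t = t"
  proof -
    have "y = x" "n + 5 - x - y = x" using that unfolding t_def rot_fixed_iff by blast+
    then show ?thesis using assms by (auto simp: t_def)
  qed
  ultimately show ?thesis by blast
qed

end

section \<open>Assembling the collections by the residue of \<open>n\<close> modulo 3\<close>

theorem theorem3p18:
  fixes n :: nat and xs :: "(nat \<times> nat) list"
  assumes "n \<ge> 7" and "linear_extension (two_by n) xs"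
  shows
    "(n mod 3 = 0 \<or> n mod 3 = 2 \<longrightarrow>
       (\<exists>C. C \<subseteq> rowmotion_orbits (two_by n) xs \<and> finite C \<and>
            real (card C) = 1 / 3 * real ((n - 5) choose 2) \<and>
            (\<forall>R\<in>C. card R = n + 5) \<and>
            (\<forall>x y. x \<ge> 4 \<and> y \<ge> 4 \<and> x + y \<le> n + 1 \<longrightarrow>
               block (x - 1) y (n + 1 - x - y) \<in> \<Union>C))) \<and>
     (n mod 3 = 1 \<longrightarrow>
       (\<exists>Q C. Q \<in> rowmotion_orbits (two_by n) xs \<and>
            real (card Q) = (real n + 5) / 3 \<and>
            C \<subseteq> rowmotion_orbits (two_by n) xs \<and> finite C \<and>
            real (card C) = (real n - 4) * (real n - 7) / 6 \<and>
            (\<forall>R\<in>C. card R = n + 5) \<and>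
            (\<forall>x y. x \<ge> 4 \<and> y \<ge> 4 \<and> x + y \<le> n + 1 \<longrightarrow>
               block (x - 1) y (n + 1 - x - y) \<in> \<Union>(insert Q C))))"
proof -
  interpret two_row_poset n xs by unfold_locales (rule assms(2))
  have card: "3 * card long_orbits = ((n - 5) choose 2) - (if n mod 3 = 1 then 1 else 0)"
    using three_times_card_orbits card_nondegenerate[OF assms(1)] by (simp add: long_orbits_def)
  show ?thesis
  proof (intro conjI impI)
    assume n: "n mod 3 = 0 \<or> n mod 3 = 2"
    have "block (x - 1) y (n + 1 - x - y) \<in> \<Union>long_orbits"
      if "4 \<le> x \<and> 4 \<le> y \<and> x + y \<le> n + 1" for x y
    proof -
      \<comment> \<open>This excludes the second alternative of
        \<open>block_in_orbit\<close>.\<close>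
      have "3 * x \<noteq> n + 5" using n by presburger
      then show ?thesis using block_in_orbit that by blast
    qed
    moreover have "real (card long_orbits) = 1 / 3 * real ((n - 5) choose 2)"
      using card n by auto
    ultimately show "\<exists>C. C \<subseteq> rowmotion_orbits (two_by n) xs \<and> finite C \<and>
            real (card C) = 1 / 3 * real ((n - 5) choose 2) \<and>
            (\<forall>R\<in>C. card R = n + 5) \<and>
            (\<forall>x y. x \<ge> 4 \<and> y \<ge> 4 \<and> x + y \<le> n + 1 \<longrightarrow>
               block (x - 1) y (n + 1 - x - y) \<in> \<Union>C)"
      using long_orbits by (intro exI[of _ long_orbits]) blast
  next
    assume n: "n mod 3 = 1"
    define c where "c = (n + 5) div 3"
    define Q where "Q = orbit row (seg (c, c, c))"
    have c: "3 * c = n + 5" "4 \<le> c" using n assms(1) unfolding c_def by presburger+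
    then have t: "(c, c, c) \<in> triples n" by (simp add: triples_def)
    have Q: "Q \<in> rowmotion_orbits (two_by n) xs"
      using seg_in_ICS[OF t] by (auto simp: Q_def rowmotion_orbits_def)
    have "card Q = c" using card_orbit_seg[OF t] by (simp add: Q_def c_def)
    moreover have "3 * real c = real n + 5" using c by linarith
    ultimately have cQ: "real (card Q) = (real n + 5) / 3" by simp
    have "real (card long_orbits) = (real n - 4) * (real n - 7) / 6"
    proof -
      \<comment> \<open>Writing \<open>n = m + 7\<close> avoids truncated subtraction:
        \<open>((m + 2) choose 2) - 1\<close> is half of \<open>m * (m + 3)\<close>, where
        \<open>m + 3 = n - 4\<close>.\<close>
      obtain m where m: "n = m + 7" using assms(1) by (metis add.commute le_Suc_ex)
      have "3 * card long_orbits = (m + 2) * (m + 1) div 2 - 1"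
        using card n by (simp add: m choose_two)
      moreover have "2 * ((m + 2) * (m + 1) div 2) = (m + 2) * (m + 1)"
        by (rule dvd_mult_div_cancel) simp
      moreover have "(m + 2) * (m + 1) = m * m + 3 * m + 2" by (simp add: algebra_simps)
      ultimately have "6 * card long_orbits = m * m + 3 * m" by linarith
      then have "6 * real (card long_orbits) = real m * real m + 3 * real m"
        by (metis of_nat_add of_nat_mult of_nat_numeral)
      then show ?thesis by (simp add: m field_simps)
    qed
    moreover have "block (x - 1) y (n + 1 - x - y) \<in> \<Union>(insert Q long_orbits)"
      if "4 \<le> x \<and> 4 \<le> y \<and> x + y \<le> n + 1" for x y
    proof -
      \<comment> \<open>The second alternative of \<open>block_in_orbit\<close> thus means
        \<open>x = y = c\<close>, which places the block in \<open>Q\<close>.\<close>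
      have "x = c" if "3 * x = n + 5" using that c by simp
      then show ?thesis using block_in_orbit[of x y] that by (auto simp: Q_def)
    qed
    ultimately show "\<exists>Q C. Q \<in> rowmotion_orbits (two_by n) xs \<and>
            real (card Q) = (real n + 5) / 3 \<and>
            C \<subseteq> rowmotion_orbits (two_by n) xs \<and> finite C \<and>
            real (card C) = (real n - 4) * (real n - 7) / 6 \<and>
            (\<forall>R\<in>C. card R = n + 5) \<and>
            (\<forall>x y. x \<ge> 4 \<and> y \<ge> 4 \<and> x + y \<le> n + 1 \<longrightarrow>
               block (x - 1) y (n + 1 - x - y) \<in> \<Union>(insert Q C))"
      using long_orbits Q cQ by (intro exI[of _ Q] exI[of _ long_orbits]) blast
  qed
qed

end
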